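(* Fix $\alpha$ with $0 \leq \alpha < n$, and let $p(\cdot) \in \mathcal{P}(\mathbb{R}^n)$ satisfy $p_+\le\frac{n}{\alpha}$. Define $q(\cdot) \in \mathcal{P}(\mathbb{R}^n)$ by $\frac{1}{p(x)} - \frac{1}{q(x)} = \frac{\alpha}{n}$, $x\in\mathbb{R}^n$. If $M_\alpha : L^{p(\cdot)}(\mathbb{R}^n) \to L^{q(\cdot),\infty}(\mathbb{R}^n)$, then $p(\cdot) \in K_0^\alpha(\mathbb{R}^n)$.
   Context: Conventions: $1/\infty = 0$, and $n/\alpha=\infty$ when $\alpha=0$. $\mathcal{P}(\mathbb{R}^n)$ is the set of Lebesgue measurable functions $p(\cdot):\mathbb{R}^n\to[1,\infty]$ (exponent functions); $p_+=\operatorname{ess\,sup}_{x\in\mathbb{R}^n} p(x)$. The conjugate exponent $p'(\cdot)$ is defined pointwise by $\frac1{p(x)}+\frac1{p'(x)}=1$. Modular: with $\Omega_\infty=\{x\in\mathbb{R}^n: p(x)=\infty\}$, $\rho_{p(\cdot)}(f)=\int_{\mathbb{R}^n\setminus\Omega_\infty}|f(x)|^{p(x)}\,dx+\|f\|_{L^\infty(\Omega_\infty)}$. Norm: $\|f\|_{p(\cdot)}=\inf\{\lambda>0:\rho_{p(\cdot)}(f/\lambda)\le 1\}$. $L^{p(\cdot)}(\mathbb{R}^n)$ is the set of measurable $f$ with $\rho_{p(\cdot)}(f/\lambda)<\infty$ for some $\lambda>0$. Fractional maximal operator: $M_\alpha f(x)=\sup_{Q\ni x}|Q|^{\frac{\alpha}{n}}\frac{1}{|Q|}\int_Q|f(y)|\,dy$,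 where the supremum is over cubes $Q\subset\mathbb{R}^n$ containing $x$ with sides parallel to the coordinate axes. For an operator $T$, $T:L^{p(\cdot)}(\mathbb{R}^n)\to L^{q(\cdot),\infty}(\mathbb{R}^n)$ (weak $(p(\cdot),q(\cdot))$ inequality) means that there is a constant $C$ such that for every $\lambda>0$ and $f\in L^{p(\cdot)}(\mathbb{R}^n)$, $\|\chi_{\{x\in\mathbb{R}^n:|Tf(x)|>\lambda\}}\|_{q(\cdot)}\le \frac{C}{\lambda}\|f\|_{p(\cdot)}$. $p(\cdot)\in K_0^\alpha(\mathbb{R}^n)$ means $\sup_Q|Q|^{\frac{\alpha}{n}-1}\|\chi_Q\|_{p'(\cdot)}\|\chi_Q\|_{q(\cdot)}<\infty$, where the supremum is over cubes $Q\subset\mathbb{R}^n$ with sides parallel to the coordinate axes. *)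

theory Defs
  imports "HOL-Analysis.Analysis" "HOL-Probability.Essential_Supremum"
begin

text \<open>
  Exponents take values in \<^typ>\<open>ereal\<close>, where \<open>1 / \<infinity> = 0\<close>, \<open>1 / 0 = \<infinity>\<close>, and hence
  \<open>n / \<alpha> = \<infinity>\<close> for \<open>\<alpha> = 0\<close>. Integrals, norms and maximal functions take values in
  \<^typ>\<open>ennreal\<close>. The dimension is \<open>n = CARD('n)\<close>.
\<close>

definition exponents :: "(real ^ 'n \<Rightarrow> ereal) set" where
  "exponents = {p \<in> borel_measurable lebesgue. \<forall>x. 1 \<le> p x}"

definition ess_sup_exponent :: "(real ^ 'n \<Rightarrow> ereal) \<Rightarrow> ereal" where
  "ess_sup_exponent p = esssup lebesgue p"

definition conj_exponent :: "(real ^ 'n \<Rightarrow> ereal) \<Rightarrow> real ^ 'n \<Rightarrow> ereal" where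
  "conj_exponent p x = 1 / (1 - 1 / p x)"

lemma conj_exponent_ge_1:
  assumes "1 \<le> p x"
  shows "1 \<le> conj_exponent p x"
  using assms unfolding conj_exponent_def
  by (cases "p x") (auto simp: one_ereal_def zero_ereal_def divide_simps)

lemma conj_exponent_unique:
  assumes "1 \<le> p x" and "1 \<le> s"
  shows "1 / p x + 1 / s = 1 \<longleftrightarrow> s = conj_exponent p x"
  using assms unfolding conj_exponent_def
  by (cases "p x"; cases s)
     (auto simp: one_ereal_def zero_ereal_def field_simps split: if_splits)

text \<open>
  The essential supremum is taken in \<^typ>\<open>ennreal\<close>, so it is \<open>0\<close> when the set where
  \<open>p = \<infinity>\<close> is null.
\<close>

definition modular :: "(real ^ 'n \<Rightarrow> ereal) \<Rightarrow> (real ^ 'n \<Rightarrow> real) \<Rightarrow> ennreal" where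
  "modular p f =
     (\<integral>\<^sup>+ x \<in> - {x. p x = \<infinity>}. ennreal (\<bar>f x\<bar> powr real_of_ereal (p x)) \<partial>lebesgue)
     + esssup (restrict_space lebesgue {x. p x = \<infinity>}) (\<lambda>x. ennreal \<bar>f x\<bar>)"

definition var_norm :: "(real ^ 'n \<Rightarrow> ereal) \<Rightarrow> (real ^ 'n \<Rightarrow> real) \<Rightarrow> ennreal" where
  "var_norm p f = Inf {ennreal l | l. 0 < l \<and> modular p (\<lambda>x. f x / l) \<le> 1}"

definition var_Lebesgue :: "(real ^ 'n \<Rightarrow> ereal) \<Rightarrow> (real ^ 'n \<Rightarrow> real) set" where
  "var_Lebesgue p =
     {f \<in> borel_measurable lebesgue. \<exists>l>0. modular p (\<lambda>x. f x / l) < \<infinity>}"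

definition cubes :: "(real ^ 'n) set set" where
  "cubes = {cbox a (\<chi> i. a $ i + l) | a l. 0 < l}"

definition frac_maximal :: "real \<Rightarrow> (real ^ 'n \<Rightarrow> real) \<Rightarrow> real ^ 'n \<Rightarrow> ennreal" where
  "frac_maximal \<alpha> f x =
     (SUP Q \<in> {Q \<in> cubes. x \<in> Q}.
        ennreal (measure lebesgue Q powr (\<alpha> / real CARD('n)) * (1 / measure lebesgue Q))
        * (\<integral>\<^sup>+ y \<in> Q. ennreal \<bar>f y\<bar> \<partial>lebesgue))"

definition weak_type ::
  "((real ^ 'n \<Rightarrow> real) \<Rightarrow> real ^ 'n \<Rightarrow> ennreal) \<Rightarrow>
   (real ^ 'n \<Rightarrow> ereal) \<Rightarrow> (real ^ 'n \<Rightarrow> ereal) \<Rightarrow> bool" where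
  "weak_type T p q \<longleftrightarrow>
     (\<exists>C\<ge>0. \<forall>l>0. \<forall>f \<in> var_Lebesgue p.
        var_norm q (indicator {x. T f x > ennreal l}) \<le> ennreal (C / l) * var_norm p f)"

definition K0 ::
  "real \<Rightarrow> (real ^ 'n \<Rightarrow> ereal) \<Rightarrow> (real ^ 'n \<Rightarrow> ereal) \<Rightarrow> bool" where
  "K0 \<alpha> p q \<longleftrightarrow>
     (SUP Q \<in> cubes.
        ennreal (measure lebesgue Q powr (\<alpha> / real CARD('n) - 1))
        * var_norm (conj_exponent p) (indicator Q) * var_norm q (indicator Q)) < \<infinity>"

text \<open>
  The exponent \<open>q\<close> is determined by \<open>1 / p - 1 / q = \<alpha> / n\<close>. A bound on the essential supremum of \<open>p\<close>
  still allows \<open>p > n / \<alpha>\<close> on a null set, where no such \<open>q\<close> exists, so the relation is required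
  almost everywhere.
\<close>

definition frac_exponent ::
  "real \<Rightarrow> (real ^ 'n \<Rightarrow> ereal) \<Rightarrow> (real ^ 'n \<Rightarrow> ereal) \<Rightarrow> bool" where
  "frac_exponent \<alpha> p q \<longleftrightarrow>
     q \<in> exponents \<and>
     (AE x in lebesgue. 1 / p x - 1 / q x = ereal (\<alpha> / real CARD('n)))"

end

theory Submission
  imports Defs
begin

text \<open>
  The idea is to test the weak inequality, for each cube \<open>Q\<close>, on a function that nearly attains the
  norm of \<open>\<chi>\<^sub>Q\<close> in the dual space, and to note that \<open>M\<^sub>\<alpha> f\<close> is at least
  \<open>|Q|\<^bsup>\<alpha>/n - 1\<^esup> \<integral>\<^sub>Q |f|\<close> at every point of \<open>Q\<close>.

  The dual part is \<open>conj_norm_indicator_duality\<close>: whenever \<open>l < \<parallel>\<chi>\<^sub>Q\<parallel>\<close> in the norm of \<open>p'\<close>, some \<open>f\<close>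
  with modular at most \<open>1\<close> has \<open>\<integral>\<^sub>Q |f| > l / 4\<close>. By definition of the norm, the \<open>p'\<close>-modular of
  \<open>\<chi>\<^sub>Q / l\<close> exceeds \<open>1\<close>, so one of its two summands exceeds \<open>1 / 2\<close>. If it is the integral over
  \<open>{p' < \<infinity>}\<close>, then \<open>f\<close> is a multiple of \<open>l\<^bsup>1 - p'\<^esup>\<close>, as in the equality case of Hoelder's inequality,
  restricted to a set where \<open>p'\<close> is bounded so that everything is finite. If it is the essential
  supremum over \<open>{p' = \<infinity>} = {p = 1}\<close>, then \<open>Q\<close> meets \<open>{p = 1}\<close> in a set of positive measure and
  \<open>l < 2\<close>, and the normalized indicator of that set serves.

  For such an \<open>f\<close> and \<open>t = |Q|\<^bsup>\<alpha>/n - 1\<^esup> l / 4\<close> the cube lies in \<open>{M\<^sub>\<alpha> f > t}\<close>, so the weak inequality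
  bounds the \<open>q\<close>-norm of \<open>\<chi>\<^sub>Q\<close> by \<open>C / t\<close>. Multiplying out, and letting \<open>l\<close> increase to
  the \<open>p'\<close>-norm of \<open>\<chi>\<^sub>Q\<close>, bounds the quantity in the definition of \<open>K0\<close> by \<open>4 * C\<close> for every cube
  (\<open>weak_type_cube_bound\<close>).
\<close>

section \<open>The conjugate exponent\<close>

lemma conj_exponent_eq_infinity_iff:
  assumes "1 \<le> p x"
  shows "conj_exponent p x = \<infinity> \<longleftrightarrow> p x = 1"
  using assms unfolding conj_exponent_def
  by (cases "p x") (auto simp: one_ereal_def zero_ereal_def divide_simps)

lemma conj_exponent_at_infinity: "p x = \<infinity> \<Longrightarrow> conj_exponent p x = 1"
  unfolding conj_exponent_def by (simp add: one_ereal_def zero_ereal_def)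

lemma conj_exponent_real:
  assumes "p x = ereal r" "1 < r"
  shows "conj_exponent p x = ereal (r / (r - 1))"
  using assms unfolding conj_exponent_def
  by (auto simp: one_ereal_def zero_ereal_def divide_simps)

lemma conj_exponent_measurable:
  assumes "p \<in> borel_measurable lebesgue"
  shows "conj_exponent p \<in> borel_measurable lebesgue"
  unfolding conj_exponent_def[abs_def] using assms
  by (intro borel_measurable_ereal_divide borel_measurable_ereal_diff) auto

section \<open>Modular and norm\<close>

lemma one_half_ennreal: "(1 / 2 :: ennreal) = ennreal (1 / 2)"
  by (metis divide_ennreal ennreal_1 ennreal_numeral zero_le_numeral zero_le_one zero_less_numeral)

lemma var_norm_le_1:
  assumes "modular p f \<le> 1"
  shows "var_norm p f \<le> 1"
  unfolding var_norm_def using assms by (intro Inf_lower) (auto intro!: exI[of _ 1])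

lemma modular_gt_1_if_less_var_norm:
  assumes "0 < l" "ennreal l < var_norm p f"
  shows "1 < modular p (\<lambda>x. f x / l)"
proof (rule ccontr)
  assume "\<not> ?thesis"
  then have "var_norm p f \<le> ennreal l"
    unfolding var_norm_def using assms(1) by (intro Inf_lower) auto
  then show False using assms(2) by simp
qed

text \<open>
  Here \<open>B\<close> will be a superlevel set of a maximal function. If it is not measurable, the inequality
  still holds: the essential supremum of a non-measurable function is \<open>\<top>\<close> by definition, and
  \<open>nn_integral\<close> is monotone on arbitrary functions.
\<close>

lemma var_norm_indicator_mono:
  assumes "A \<subseteq> B" "A \<in> sets lebesgue"
  shows "var_norm q (indicator A) \<le> var_norm q (indicator B)"
proof -
  have le: "\<bar>indicator A x / l\<bar> \<le> \<bar>indicator B x / l\<bar>" for x and l :: real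
    using assms(1) by (auto simp: indicator_def)
  have [measurable]: "A \<in> sets lebesgue" by fact
  have "modular q (\<lambda>x. indicator A x / l) \<le> modular q (\<lambda>x. indicator B x / l)" for l :: real
    unfolding modular_def
  proof (intro add_mono nn_integral_mono esssup_mono)
    fix x
    show "ennreal (\<bar>indicator A x / l\<bar> powr real_of_ereal (q x)) * indicator (- {x. q x = \<infinity>}) x
        \<le> ennreal (\<bar>indicator B x / l\<bar> powr real_of_ereal (q x)) * indicator (- {x. q x = \<infinity>}) x"
      using assms(1) by (auto simp: indicator_def)
    show "ennreal \<bar>indicator A x / l\<bar> \<le> ennreal \<bar>indicator B x / l\<bar>"
      using le by (intro ennreal_leI)
  next
    show "(\<lambda>x. ennreal \<bar>indicator A x / l\<bar>) \<in> borel_measurable (restrict_space lebesgue {x. q x = \<infinity>})"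
      by (intro measurable_restrict_space1) measurable
  qed
  then show ?thesis
    unfolding var_norm_def by (intro Inf_superset_mono) (auto intro: order_trans)
qed

section \<open>Test functions for the norm of an indicator function\<close>

text \<open>
  Where \<open>p = 1\<close> the modular is the \<open>L\<^sup>1\<close> norm, so it agrees with the integral on the normalized
  indicator of \<open>{x \<in> E. p x = 1}\<close>.
\<close>

lemma test_function_where_exponent_1:
  fixes p :: "real ^ 'n \<Rightarrow> ereal"
  assumes p: "p \<in> exponents" and E: "E \<in> lmeasurable"
    and pos: "emeasure lebesgue {x \<in> E. p x = 1} \<noteq> 0"
  obtains f where "f \<in> borel_measurable lebesgue" "modular p f \<le> 1"
    "(\<integral>\<^sup>+ x \<in> E. ennreal \<bar>f x\<bar> \<partial>lebesgue) = 1"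
proof -
  have [measurable]: "p \<in> borel_measurable lebesgue"
    using p by (simp add: exponents_def)
  have [measurable]: "E \<in> sets lebesgue" using E by auto
  define F where "F = {x \<in> E. p x = 1}"
  have F_eq: "F = E \<inter> (p -` {1} \<inter> space lebesgue)" by (auto simp: F_def)
  have [measurable]: "F \<in> sets lebesgue" unfolding F_eq by measurable
  have "F \<in> lmeasurable"
    by (rule fmeasurableI2[OF E]) (auto simp: F_def)
  then have em: "emeasure lebesgue F = ennreal (measure lebesgue F)"
    by (simp add: emeasure_eq_measure2)
  have mpos: "0 < measure lebesgue F"
    using pos em unfolding F_def[symmetric]
    by (metis ennreal_0 measure_nonneg order_le_less)
  define f where "f x = indicator F x / measure lebesgue F" for x
  have [measurable]: "f \<in> borel_measurable lebesgue"
    unfolding f_def by measurable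
  have val: "(\<integral>\<^sup>+ x. ennreal (1 / measure lebesgue F) * indicator F x \<partial>lebesgue) = 1"
    using mpos by (subst nn_integral_cmult_indicator) (auto simp: em ennreal_mult[symmetric])
  have "(\<integral>\<^sup>+ x \<in> - {x. p x = \<infinity>}. ennreal (\<bar>f x\<bar> powr real_of_ereal (p x)) \<partial>lebesgue) = 1"
    unfolding val[symmetric] using mpos
    by (intro nn_integral_cong) (auto simp: f_def indicator_def F_def one_ereal_def)
  moreover have "esssup (restrict_space lebesgue {x. p x = \<infinity>}) (\<lambda>x. ennreal \<bar>f x\<bar>) \<le> 0"
  proof (rule esssup_I)
    show "(\<lambda>x. ennreal \<bar>f x\<bar>) \<in> borel_measurable (restrict_space lebesgue {x. p x = \<infinity>})"
      by (intro measurable_restrict_space1) measurable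
    show "AE x in restrict_space lebesgue {x. p x = \<infinity>}. ennreal \<bar>f x\<bar> \<le> 0"
      by (intro AE_I2) (auto simp: f_def F_def indicator_def space_restrict_space)
  qed
  ultimately have "modular p f \<le> 1"
    unfolding modular_def by simp
  moreover have "(\<integral>\<^sup>+ x \<in> E. ennreal \<bar>f x\<bar> \<partial>lebesgue) = 1"
    unfolding val[symmetric] using mpos
    by (intro nn_integral_cong) (auto simp: f_def indicator_def F_def)
  ultimately show thesis
    using that[of f] by simp
qed

text \<open>
  Write \<open>s\<close> for the conjugate exponent. The function \<open>l\<^bsup>1 - s\<^esup>\<close> has \<open>p\<close>-th power \<open>l\<^bsup>- s\<^esup>\<close>
  where \<open>1 < p < \<infinity>\<close>, because \<open>(1 - s) p = - s\<close>, and it equals \<open>1\<close> where \<open>p = \<infinity>\<close>. On a set where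
  \<open>l\<^bsup>- s\<^esup>\<close> has integral \<open>J\<close>, its integral is thus \<open>l J\<close>, while both parts of its modular are
  controlled, by \<open>J\<close> and by \<open>1\<close>. Dividing by \<open>2 max J 1\<close> brings each part below \<open>1 / 2\<close>, and \<open>J > 1 / 2\<close>
  keeps the integral above \<open>l / 4\<close>.
\<close>

lemma test_function_where_exponent_gt_1:
  fixes p :: "real ^ 'n \<Rightarrow> ereal"
  assumes p: "p \<in> exponents" and E: "E \<in> lmeasurable" and l: "0 < l"
    and half: "1 / 2 < (\<integral>\<^sup>+ x \<in> E \<inter> - {x. conj_exponent p x = \<infinity>}.
                  ennreal (l powr (- real_of_ereal (conj_exponent p x))) \<partial>lebesgue)"
  obtains f where "f \<in> borel_measurable lebesgue" "modular p f \<le> 1"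
    "ennreal (l / 4) < (\<integral>\<^sup>+ x \<in> E. ennreal \<bar>f x\<bar> \<partial>lebesgue)"
proof -
  define s where "s = (\<lambda>x. real_of_ereal (conj_exponent p x))"
  define w where "w = (\<lambda>x. l powr (- s x))"
  \<comment> \<open>\<open>w\<close> may fail to be integrable on \<open>E\<close> when \<open>l < 1\<close> and \<open>s\<close> is unbounded; on \<open>A m\<close> it is bounded.\<close>
  define A where "A = (\<lambda>m::nat. {x \<in> E. conj_exponent p x \<le> ereal (real m)})"
  have pm [measurable]: "p \<in> borel_measurable lebesgue" and p1: "\<And>x. 1 \<le> p x"
    using p by (auto simp: exponents_def)
  have cm [measurable]: "conj_exponent p \<in> borel_measurable lebesgue"
    using conj_exponent_measurable[OF pm] .
  have [measurable]: "E \<in> sets lebesgue" using E by auto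
  have [measurable]: "s \<in> borel_measurable lebesgue" unfolding s_def by measurable
  have [measurable]: "w \<in> borel_measurable lebesgue" unfolding w_def by measurable
  have A_eq: "A m = E \<inter> (conj_exponent p -` {..ereal (real m)} \<inter> space lebesgue)" for m
    by (auto simp: A_def)
  have Am [measurable]: "A m \<in> sets lebesgue" for m unfolding A_eq by measurable
  have A_UN: "(\<Union>m. A m) = E \<inter> - {x. conj_exponent p x = \<infinity>}"
  proof (intro set_eqI iffI)
    fix x assume x: "x \<in> E \<inter> - {x. conj_exponent p x = \<infinity>}"
    then obtain r where "conj_exponent p x = ereal r"
      using conj_exponent_ge_1[of p x, OF p1] by (cases "conj_exponent p x") auto
    moreover obtain m :: nat where "r \<le> real m" using real_arch_simple by blast
    ultimately show "x \<in> (\<Union>m. A m)" using x by (auto simp: A_def)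
  qed (auto simp: A_def)
  have "(SUP m. \<integral>\<^sup>+ x \<in> A m. ennreal (w x) \<partial>lebesgue)
      = (SUP m. emeasure (density lebesgue (\<lambda>x. ennreal (w x))) (A m))"
    by (simp add: emeasure_density)
  also have "\<dots> = emeasure (density lebesgue (\<lambda>x. ennreal (w x))) (\<Union>m. A m)"
    by (intro SUP_emeasure_incseq incseq_SucI) (auto simp: A_def intro: order_trans)
  also have "\<dots> = (\<integral>\<^sup>+ x \<in> E \<inter> - {x. conj_exponent p x = \<infinity>}. ennreal (w x) \<partial>lebesgue)"
    by (subst emeasure_density) (simp_all add: A_UN[symmetric])
  finally have "1 / 2 < (SUP m. \<integral>\<^sup>+ x \<in> A m. ennreal (w x) \<partial>lebesgue)"
    using half by (simp add: w_def s_def)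
  then obtain m where m: "1 / 2 < (\<integral>\<^sup>+ x \<in> A m. ennreal (w x) \<partial>lebesgue)"
    by (auto simp: less_SUP_iff)
  have s1: "1 \<le> s x" "s x \<le> real m" if "x \<in> A m" for x
    using that conj_exponent_ge_1[of p x, OF p1] unfolding A_def s_def
    by (cases "conj_exponent p x"; auto simp: one_ereal_def)+
  have wb: "w x \<le> max 1 (l powr (- real m))" if "x \<in> A m" for x
  proof (cases "l \<le> 1")
    case True
    then have "w x \<le> l powr (- real m)"
      unfolding w_def using s1[OF that] l by (intro powr_mono') auto
    then show ?thesis by simp
  next
    case False
    then have "w x \<le> l powr 0"
      unfolding w_def using s1[OF that] l by (intro powr_mono) auto
    then show ?thesis using l by simp
  qed
  have "(\<integral>\<^sup>+ x \<in> A m. ennreal (w x) \<partial>lebesgue)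
      \<le> (\<integral>\<^sup>+ x. ennreal (max 1 (l powr (- real m))) * indicator (A m) x \<partial>lebesgue)"
    by (intro nn_integral_mono) (auto simp: indicator_def intro!: ennreal_leI wb)
  also have "\<dots> = ennreal (max 1 (l powr (- real m))) * emeasure lebesgue (A m)"
    by (simp add: nn_integral_cmult_indicator)
  also have "\<dots> < \<infinity>"
  proof -
    have "A m \<in> lmeasurable" by (rule fmeasurableI2[OF E]) (auto simp: A_def)
    then show ?thesis by (auto simp: ennreal_mult_less_top fmeasurable_def)
  qed
  finally obtain J where J: "(\<integral>\<^sup>+ x \<in> A m. ennreal (w x) \<partial>lebesgue) = ennreal J" "0 \<le> J"
    by (cases "\<integral>\<^sup>+ x \<in> A m. ennreal (w x) \<partial>lebesgue") auto
  have J_half: "1 / 2 < J"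
    using m unfolding J(1) one_half_ennreal
    by (rule ennreal_less_iff[THEN iffD1, rotated]) simp
  define c where "c = 2 * max J 1"
  have c: "2 \<le> c" "J \<le> c / 2" "1 / 4 < J / c"
    using J_half by (auto simp: c_def max_def field_simps)
  define f where "f = (\<lambda>x. l * w x * indicator (A m) x / c)"
  have fm [measurable]: "f \<in> borel_measurable lebesgue" unfolding f_def by measurable
  have "(\<integral>\<^sup>+ x \<in> - {x. p x = \<infinity>}. ennreal (\<bar>f x\<bar> powr real_of_ereal (p x)) \<partial>lebesgue)
      \<le> (\<integral>\<^sup>+ x. ennreal (1 / c) * (ennreal (w x) * indicator (A m) x) \<partial>lebesgue)"
  proof (rule nn_integral_mono)
    fix x
    show "ennreal (\<bar>f x\<bar> powr real_of_ereal (p x)) * indicator (- {x. p x = \<infinity>}) x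
        \<le> ennreal (1 / c) * (ennreal (w x) * indicator (A m) x)"
    proof (cases "x \<in> A m \<and> p x \<noteq> \<infinity>")
      case True
      then have "p x \<noteq> 1"
        using conj_exponent_eq_infinity_iff[of p x, OF p1] by (auto simp: A_def)
      with True obtain r where r: "p x = ereal r" "1 < r"
        using p1[of x] by (cases "p x") (auto simp: one_ereal_def order_less_le)
      have sr: "s x = r / (r - 1)"
        unfolding s_def using conj_exponent_real[of p x, OF r] by simp
      have lw: "l * w x = l powr (1 - s x)"
        using l by (simp add: w_def powr_diff powr_minus divide_simps)
      have e: "(1 - s x) * r = - s x"
        unfolding sr using r(2) by (simp add: field_simps)
      have "f x = l powr (1 - s x) / c"
        using True by (simp add: f_def lw)
      then have "\<bar>f x\<bar> powr r = w x / c powr r"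
        using c(1) by (simp add: powr_divide powr_powr e w_def)
      also have "\<dots> \<le> w x / c"
      proof -
        have "c powr 1 \<le> c powr r" using c r by (intro powr_mono) auto
        then show ?thesis using c by (intro divide_left_mono) (auto simp: w_def)
      qed
      finally show ?thesis
        using True c r by (simp add: ennreal_mult[symmetric] w_def ennreal_leI)
    qed (auto simp: f_def indicator_def)
  qed
  also have "\<dots> = ennreal (J / c)"
    using J c by (simp add: nn_integral_cmult ennreal_mult[symmetric])
  also have "\<dots> \<le> ennreal (1 / 2)"
    using c by (intro ennreal_leI) (simp add: field_simps)
  finally have fin_part: "(\<integral>\<^sup>+ x \<in> - {x. p x = \<infinity>}.
      ennreal (\<bar>f x\<bar> powr real_of_ereal (p x)) \<partial>lebesgue) \<le> ennreal (1 / 2)" .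
  have "esssup (restrict_space lebesgue {x. p x = \<infinity>}) (\<lambda>x. ennreal \<bar>f x\<bar>) \<le> ennreal (1 / 2)"
  proof (rule esssup_I)
    show "(\<lambda>x. ennreal \<bar>f x\<bar>) \<in> borel_measurable (restrict_space lebesgue {x. p x = \<infinity>})"
      by (intro measurable_restrict_space1) measurable
    show "AE x in restrict_space lebesgue {x. p x = \<infinity>}. ennreal \<bar>f x\<bar> \<le> ennreal (1 / 2)"
    proof (rule AE_I2)
      fix x assume "x \<in> space (restrict_space lebesgue {x. p x = \<infinity>})"
      then have "p x = \<infinity>" by (simp add: space_restrict_space)
      then have "s x = 1" unfolding s_def by (simp add: conj_exponent_at_infinity)
      then have "l * w x = 1" using l by (simp add: w_def powr_minus)
      then show "ennreal \<bar>f x\<bar> \<le> ennreal (1 / 2)"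
        using c by (intro ennreal_leI) (auto simp: f_def indicator_def field_simps)
    qed
  qed
  then have "modular p f \<le> ennreal (1 / 2) + ennreal (1 / 2)"
    unfolding modular_def using fin_part by (intro add_mono)
  also have "\<dots> = 1"
    by (subst ennreal_plus[symmetric]) auto
  finally have mod: "modular p f \<le> 1" .
  have "(\<integral>\<^sup>+ x \<in> E. ennreal \<bar>f x\<bar> \<partial>lebesgue)
      = (\<integral>\<^sup>+ x. ennreal (l / c) * (ennreal (w x) * indicator (A m) x) \<partial>lebesgue)"
    using l c by (intro nn_integral_cong)
      (auto simp: f_def indicator_def A_def w_def ennreal_mult[symmetric])
  also have "\<dots> = ennreal (l * (J / c))"
    using J c l by (simp add: nn_integral_cmult ennreal_mult[symmetric])
  finally have int: "(\<integral>\<^sup>+ x \<in> E. ennreal \<bar>f x\<bar> \<partial>lebesgue) = ennreal (l * (J / c))" .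
  have "l * (1 / 4) < l * (J / c)"
    using c(3) l by (intro mult_strict_left_mono)
  then have "ennreal (l / 4) < (\<integral>\<^sup>+ x \<in> E. ennreal \<bar>f x\<bar> \<partial>lebesgue)"
    unfolding int using l by (subst ennreal_less_iff) auto
  with mod fm show thesis using that by blast
qed

text \<open>
  A converse to Hoelder's inequality for indicator functions. One factor \<open>2\<close> of the constant \<open>4\<close> comes
  from splitting the \<open>p'\<close>-modular into its two summands, the other from making both summands
  of the \<open>p\<close>-modular of the test function at most \<open>1 / 2\<close>.
\<close>

lemma conj_norm_indicator_duality:
  fixes p :: "real ^ 'n \<Rightarrow> ereal"
  assumes p: "p \<in> exponents" and E: "E \<in> lmeasurable" and l: "0 < l"
    and less: "ennreal l < var_norm (conj_exponent p) (indicator E)"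
  obtains f where "f \<in> borel_measurable lebesgue" "modular p f \<le> 1"
    "ennreal (l / 4) < (\<integral>\<^sup>+ x \<in> E. ennreal \<bar>f x\<bar> \<partial>lebesgue)"
proof -
  let ?q = "conj_exponent p"
  let ?S = "{x. ?q x = \<infinity>}"
  have pm [measurable]: "p \<in> borel_measurable lebesgue" and p1: "\<And>x. 1 \<le> p x"
    using p by (auto simp: exponents_def)
  have cm [measurable]: "?q \<in> borel_measurable lebesgue"
    using conj_exponent_measurable[OF pm] .
  have Em [measurable]: "E \<in> sets lebesgue" using E by auto
  define a where "a = (\<integral>\<^sup>+ x \<in> - ?S. ennreal (\<bar>indicator E x / l\<bar> powr real_of_ereal (?q x)) \<partial>lebesgue)"
  define b where "b = esssup (restrict_space lebesgue ?S) (\<lambda>x. ennreal \<bar>indicator E x / l\<bar>)"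
  have "1 < a + b"
    using modular_gt_1_if_less_var_norm[OF l less] by (simp add: modular_def a_def b_def)
  moreover have "a + b \<le> 1" if "a \<le> 1 / 2" "b \<le> 1 / 2"
  proof -
    have "a + b \<le> ennreal (1 / 2) + ennreal (1 / 2)"
      using that unfolding one_half_ennreal by (intro add_mono)
    also have "\<dots> = 1" by (subst ennreal_plus[symmetric]) auto
    finally show ?thesis .
  qed
  ultimately consider "1 / 2 < a" | "1 / 2 < b" by (meson leD not_le)
  then show thesis
  proof cases
    case 1
    have "a = (\<integral>\<^sup>+ x \<in> E \<inter> - ?S. ennreal (l powr (- real_of_ereal (?q x))) \<partial>lebesgue)"
      unfolding a_def using l
      by (intro nn_integral_cong) (auto simp: indicator_def powr_divide powr_minus divide_simps)
    with 1 show thesis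
      using test_function_where_exponent_gt_1[OF p E l] that by metis
  next
    case 2
    have S_eq: "?S = {x. p x = 1}" using conj_exponent_eq_infinity_iff p1 by blast
    have S: "?S \<inter> space lebesgue \<in> sets lebesgue"
    proof -
      have "?q -` {\<infinity>} \<inter> space lebesgue \<in> sets lebesgue" by measurable
      then show ?thesis by (simp add: vimage_def)
    qed
    have meas: "(\<lambda>x. ennreal \<bar>indicator E x / l\<bar>) \<in> borel_measurable (restrict_space lebesgue ?S)"
      by (intro measurable_restrict_space1) measurable
    have l2: "l < 2"
    proof (rule ccontr)
      assume "\<not> l < 2"
      then have "b \<le> ennreal (1 / 2)"
        unfolding b_def using l
        by (intro esssup_I[OF meas] AE_I2 ennreal_leI) (auto simp: indicator_def field_simps)
      with 2 show False by (simp add: one_half_ennreal)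
    qed
    have "emeasure lebesgue {x \<in> E. p x = 1} \<noteq> 0"
    proof
      assume null: "emeasure lebesgue {x \<in> E. p x = 1} = 0"
      have "{x \<in> E. p x = 1} = E \<inter> (?S \<inter> space lebesgue)" using S_eq by auto
      then have "{x \<in> E. p x = 1} \<in> sets lebesgue" using S by (metis Em sets.Int)
      with null have "{x \<in> E. p x = 1} \<in> null_sets lebesgue" by auto
      then have "AE x in lebesgue. x \<notin> {x \<in> E. p x = 1}" by (rule AE_not_in)
      then have "AE x in restrict_space lebesgue ?S. ennreal \<bar>indicator E x / l\<bar> \<le> 0"
        unfolding AE_restrict_space_iff[OF S]
        by (rule eventually_mono) (auto simp: S_eq indicator_def)
      then have "b \<le> 0" unfolding b_def by (rule esssup_I[OF meas])
      with 2 show False by simp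
    qed
    then obtain f where "f \<in> borel_measurable lebesgue" "modular p f \<le> 1"
      "(\<integral>\<^sup>+ x \<in> E. ennreal \<bar>f x\<bar> \<partial>lebesgue) = 1"
      using test_function_where_exponent_1[OF p E] by blast
    moreover have "ennreal (l / 4) < 1" using l l2 by (simp add: ennreal_less_one_iff)
    ultimately show thesis using that by metis
  qed
qed

section \<open>The fractional maximal function on a cube\<close>

lemma cube_lmeasurable_pos:
  assumes "Q \<in> cubes"
  shows "Q \<in> lmeasurable" "0 < measure lebesgue Q"
proof -
  obtain a l where Q: "Q = cbox a (\<chi> i. a $ i + l)" "0 < l"
    using assms by (auto simp: cubes_def)
  show "Q \<in> lmeasurable" by (simp add: Q)
  have "0 < measure lborel Q"
    unfolding Q(1) content_pos_lt_eq using Q(2)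
    by (auto simp: Basis_vec_def inner_axis)
  then show "0 < measure lebesgue Q" by (simp add: Q)
qed

lemma frac_maximal_ge_average:
  assumes "Q \<in> cubes" "x \<in> Q"
  shows "ennreal (measure lebesgue Q powr (\<alpha> / real CARD('n) - 1)) *
      (\<integral>\<^sup>+ y \<in> Q. ennreal \<bar>f y\<bar> \<partial>lebesgue) \<le> frac_maximal \<alpha> f (x :: real ^ 'n)"
proof -
  have "measure lebesgue Q powr (\<alpha> / real CARD('n) - 1)
      = measure lebesgue Q powr (\<alpha> / real CARD('n)) * (1 / measure lebesgue Q)"
    using cube_lmeasurable_pos(2)[OF assms(1)] by (simp add: powr_diff)
  then show ?thesis
    unfolding frac_maximal_def using assms by (intro SUP_upper2[of Q]) auto
qed

text \<open>
  Duality provides a test function only for real numbers strictly below the conjugate norm, which could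
  a priori be infinite. So the bound is proved with any such \<open>y\<close> in place of that norm, with a
  constant independent of \<open>y\<close>, and then passes to the supremum over \<open>y\<close>.
\<close>

lemma weak_type_cube_bound:
  fixes p q :: "real ^ 'n \<Rightarrow> ereal"
  assumes p: "p \<in> exponents" and Q: "Q \<in> cubes" and C: "0 \<le> C"
    and weak: "\<And>l f. 0 < l \<Longrightarrow> f \<in> var_Lebesgue p \<Longrightarrow>
      var_norm q (indicator {x. frac_maximal \<alpha> f x > ennreal l}) \<le> ennreal (C / l) * var_norm p f"
  shows "ennreal (measure lebesgue Q powr (\<alpha> / real CARD('n) - 1))
    * var_norm (conj_exponent p) (indicator Q) * var_norm q (indicator Q) \<le> ennreal (4 * C)"
proof -
  define k where "k = measure lebesgue Q powr (\<alpha> / real CARD('n) - 1)"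
  define N where "N = var_norm (conj_exponent p) (indicator Q)"
  define X where "X = var_norm q (indicator Q)"
  note Qm = cube_lmeasurable_pos[OF Q]
  have k: "0 < k" using Qm by (simp add: k_def)
  have bound: "ennreal k * y * X \<le> ennreal (4 * C)" if y: "y < N" for y
  proof (cases "y = 0")
    case False
    then obtain l where l: "y = ennreal l" "0 < l"
      using y by (cases y) (auto simp: order_le_less)
    obtain f where f: "f \<in> borel_measurable lebesgue" "modular p f \<le> 1"
      "ennreal (l / 4) < (\<integral>\<^sup>+ x \<in> Q. ennreal \<bar>f x\<bar> \<partial>lebesgue)"
      using conj_norm_indicator_duality[OF p Qm(1) l(2)] y unfolding N_def l(1) by metis
    define t where "t = k * (l / 4)"
    have t: "0 < t" using k l by (simp add: t_def)
    have "Q \<subseteq> {x. frac_maximal \<alpha> f x > ennreal t}"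
    proof
      fix x assume "x \<in> Q"
      have "ennreal t = ennreal k * ennreal (l / 4)"
        unfolding t_def using k l by (intro ennreal_mult) auto
      also have "\<dots> < ennreal k * (\<integral>\<^sup>+ x \<in> Q. ennreal \<bar>f x\<bar> \<partial>lebesgue)"
        using f(3) k by (intro ennreal_mult_strict_left_mono) auto
      also have "\<dots> \<le> frac_maximal \<alpha> f x"
        unfolding k_def by (rule frac_maximal_ge_average[OF Q \<open>x \<in> Q\<close>])
      finally show "x \<in> {x. frac_maximal \<alpha> f x > ennreal t}" by simp
    qed
    then have "X \<le> var_norm q (indicator {x. frac_maximal \<alpha> f x > ennreal t})"
      unfolding X_def using Qm by (intro var_norm_indicator_mono) auto
    also have "\<dots> \<le> ennreal (C / t) * var_norm p f"
    proof (rule weak[OF t])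
      have "modular p (\<lambda>x. f x / 1) < \<infinity>"
        using f(2) by (simp add: le_less_trans)
      then show "f \<in> var_Lebesgue p"
        unfolding var_Lebesgue_def using f(1) zero_less_one by blast
    qed
    also have "\<dots> \<le> ennreal (C / t) * 1"
      using var_norm_le_1[OF f(2)] by (intro mult_left_mono) auto
    finally have X: "X \<le> ennreal (C / t)" by simp
    have "ennreal k * y * X \<le> ennreal (k * l) * ennreal (C / t)"
      using X k l by (auto simp: ennreal_mult intro!: mult_left_mono)
    also have "\<dots> = ennreal (k * l * (C / t))"
      using k l t C by (subst ennreal_mult) auto
    also have "k * l * (C / t) = 4 * C"
      using k l by (simp add: t_def field_simps)
    finally show ?thesis .
  qed simp
  have "ennreal k * N * X = ennreal k * (SUP y\<in>{..<N}. y) * X"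
    by simp
  also have "\<dots> = (SUP y\<in>{..<N}. ennreal k * y * X)"
    by (simp only: SUP_mult_left_ennreal SUP_mult_right_ennreal)
  also have "\<dots> \<le> ennreal (4 * C)"
    by (intro SUP_least bound) simp
  finally show ?thesis unfolding k_def N_def X_def .
qed

theorem theorem1p5:
  fixes \<alpha> :: real and p q :: "real ^ 'n \<Rightarrow> ereal"
  assumes "0 \<le> \<alpha>" and "\<alpha> < real CARD('n)"
    and "p \<in> exponents"
    and "ess_sup_exponent p \<le> ereal (real CARD('n)) / ereal \<alpha>"
    and "frac_exponent \<alpha> p q"
    and "weak_type (frac_maximal \<alpha>) p q"
  shows "K0 \<alpha> p q"
proof -
  obtain C where C: "0 \<le> C" "\<And>l f. 0 < l \<Longrightarrow> f \<in> var_Lebesgue p \<Longrightarrow>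
      var_norm q (indicator {x. frac_maximal \<alpha> f x > ennreal l}) \<le> ennreal (C / l) * var_norm p f"
    using assms(6) unfolding weak_type_def by blast
  have "(SUP Q \<in> cubes.
        ennreal (measure lebesgue Q powr (\<alpha> / real CARD('n) - 1))
        * var_norm (conj_exponent p) (indicator Q) * var_norm q (indicator Q)) \<le> ennreal (4 * C)"
    by (intro SUP_least weak_type_cube_bound[OF assms(3) _ C])
  also have "\<dots> < \<infinity>" by simp
  finally show ?thesis unfolding K0_def .
qed

end
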